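(* Let $(c_h^{n},\mu_h^{n},r_h^{n})$ be produced by the SAV-BDF2 scheme. That is, $c_h^0\in V_h$ and $r_h^0\in\mathbb{R}$ are given initial data; $(c_h^1,\mu_h^1,r_h^1)\in V_h\times V_h\times\mathbb{R}$ is obtained from one step of the SAV-BDF1 scheme, i.e. for all $(v_h,q_h)\in V_h\times V_h$, $$\rho(c_h^{1}-c_h^{0},v_h)=-\Delta t\,(M(c_h^0)\nabla_{\Gamma_h}\mu_h^{1},\nabla_{\Gamma_h}v_h)-h\Delta t\int_{\Omega_h^\Gamma}(\mathbf{n}_h\cdot\nabla\mu_h^{1})(\mathbf{n}_h\cdot\nabla v_h)\,dx,$$ $$(\mu_h^{1},q_h)=\frac{r_h^{1}}{\sqrt{E_1(c_h^0)}}(f_0'(c_h^0),q_h)+\epsilon^2(\nabla_{\Gamma_h}c_h^{1},\nabla_{\Gamma_h}q_h)+h^{-1}\epsilon^2\int_{\Omega_h^\Gamma}(\mathbf{n}_h\cdot\nabla c_h^{1})(\mathbf{n}_h\cdot\nabla q_h)\,dx,$$ $$r_h^{1}-r_h^0=\frac{1}{2\sqrt{E_1(c_h^0)}}(f_0'(c_h^0),c_h^{1}-c_h^0);$$ and for every $n\ge1$, with $\tilde c_h^n=2c_h^n-c_h^{n-1}$, the triple $(c_h^{n+1},\mu_h^{n+1},r_h^{n+1})\in V_h\times V_h\times\mathbb{R}$ satisfies, for all $(v_h,q_h)\in V_h\times V_h$, $$\frac{\rho}{2\Delta t}(3c_h^{n+1}-4c_h^n+c_h^{n-1},v_h)=-(M(\tilde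 c_h^n)\nabla_{\Gamma_h}\mu_h^{n+1},\nabla_{\Gamma_h}v_h)-h\int_{\Omega_h^\Gamma}(\mathbf{n}_h\cdot\nabla\mu_h^{n+1})(\mathbf{n}_h\cdot\nabla v_h)\,dx,$$ $$(\mu_h^{n+1},q_h)=\frac{r_h^{n+1}}{\sqrt{E_1(\tilde c_h^n)}}(f_0'(\tilde c_h^n),q_h)+\epsilon^2(\nabla_{\Gamma_h}c_h^{n+1},\nabla_{\Gamma_h}q_h)+h^{-1}\epsilon^2\int_{\Omega_h^\Gamma}(\mathbf{n}_h\cdot\nabla c_h^{n+1})(\mathbf{n}_h\cdot\nabla q_h)\,dx,$$ $$3r_h^{n+1}-4r_h^n+r_h^{n-1}=\frac{1}{2\sqrt{E_1(\tilde c_h^n)}}(f_0'(\tilde c_h^n),3c_h^{n+1}-4c_h^n+c_h^{n-1}).$$ Define the modified discrete energy, for $n\ge 0$, $$\tilde E_h^{n+1}=\frac{\epsilon^2}{2}\|\nabla_{\Gamma_h}c_h^{n+1}\|^2+\frac{\epsilon^2}{2}\|2\nabla_{\Gamma_h}c_h^{n+1}-\nabla_{\Gamma_h}c_h^n\|^2+|r_h^{n+1}|^2+|2r_h^{n+1}-r_h^n|^2$$ $$+\frac{h^{-1}\epsilon^2}{2}\|\mathbf{n}_h\cdot\nabla c_h^{n+1}\|^2_{L^2(\Omega_h^\Gamma)}+\frac{h^{-1}\epsilon^2}{2}\|\mathbf{n}_h\cdot\nabla(2c_h^{n+1}-c_h^n)\|^2_{L^2(\Omega_h^\Gamma)}.$$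 Then the scheme admits, for all $n\ge1$, the following energy balance: $$\left(\tilde E_h^{n+1}-\tilde E_h^{n}\right)+\frac{\epsilon^2}{2}\|\nabla_{\Gamma_h}c_h^{n+1}-2\nabla_{\Gamma_h}c_h^n+\nabla_{\Gamma_h}c_h^{n-1}\|^2+|r_h^{n+1}-2r_h^n+r_h^{n-1}|^2+\frac{h^{-1}\epsilon^2}{2}\|\mathbf{n}_h\cdot\nabla(c_h^{n+1}-2c_h^n+c_h^{n-1})\|^2_{L^2(\Omega_h^\Gamma)}$$ $$=-\frac{2\Delta t}{\rho}(M(\tilde c_h^n)\nabla_{\Gamma_h}\mu_h^{n+1},\nabla_{\Gamma_h}\mu_h^{n+1})-\frac{2h\Delta t}{\rho}\|\mathbf{n}_h\cdot\nabla\mu_h^{n+1}\|^2_{L^2(\Omega_h^\Gamma)}.$$ In particular, this implies that the scheme is energy stable in the sense that $\tilde E_h^{n+1}\le\tilde E_h^n$ for all $n\ge1$.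
   Context: Let $\Gamma\subset\mathbb{R}^3$ be a closed, sufficiently smooth surface contained in a bulk domain $\Omega\subset\mathbb{R}^3$ and given as $\Gamma=\{\mathbf{x}\in\Omega:\phi(\mathbf{x})=0\}$, where $\phi$ is sufficiently smooth (at least Lipschitz continuous) with $|\nabla\phi|$ bounded below by a positive constant in a 3D neighborhood of $\Gamma$. Let $\mathcal{T}_h$ be a triangulation of $\Omega$ into shape-regular tetrahedra, with mesh size $h>0$. $\mathcal{T}_h^\Gamma$ is the set of tetrahedra having nonempty intersection with $\Gamma$, and $\Omega_h^\Gamma$ is the domain formed by the tetrahedra in $\mathcal{T}_h^\Gamma$. The finite element space is $V_h=\{v\in C(\Omega_h^\Gamma): v\in P_1(T)\ \text{for any } T\in\mathcal{T}_h^\Gamma\}$. Let $\phi_h$ be the $P_1$ Lagrange interpolant of $\phi$ on the mesh and let the discrete surface $\Gamma_h$ be the zero level set of $\phi_h$. Set $\mathbf{n}_h=\nabla\phi_h/|\nabla\phi_h|$, $\mathbf{P}_h=\mathbf{I}-\mathbf{n}_h\mathbf{n}_h^T$, and for $v\in V_h$ the surface gradient $\nabla_{\Gamma_h}v=\mathbf{P}_h\nabla v$ on $\Gamma_h$. $(\cdot,\cdot)$ and $\|\cdot\|$ denote the $L^2(\Gamma_h)$ inner product and norm. The constants are: density $\rho>0$, interface thickness $\epsilon>0$, time step $\Delta t>0$. The free energy per unit surface is $f_0(c)=\frac14c^2(1-c)^2$, the mobility is the degenerate mobility $M(c)=c(1-c)$, and $E_1(c)=\int_\Gamma f_0(c)\,ds$.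 It is assumed throughout that $E_1(c)>0$. The initial value of the scalar auxiliary variable is $r_h^0=\sqrt{E_1(c_0)}$ with $c_0$ the initial concentration, $c_h^0\in V_h$ being its discrete counterpart.
   Formalization: The stability inequality at step n is asserted only when M(c̃_h^n) ≥ 0 on Γ_h (that is, 0 ≤ c̃_h^n ≤ 1 there), since M(c)=c(1−c) can be negative and the energy can then grow; the energy balance is unconditional. *)

theory Defs
  imports "HOL-Analysis.Analysis"
begin

section \<open>Surface measure\<close>

text \<open>
  Surface integrals, both over the smooth surface and over the piecewise planar discrete surface,
  are taken with respect to the two-dimensional Hausdorff measure.  The factor
  \<open>pi / 4\<close> is the area of a disc of diameter 1, so that the measure agrees with
  the elementary area on planes.
\<close>

definition hausdorff2_pre :: "real \<Rightarrow> (real^3) set \<Rightarrow> ennreal" where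
  "hausdorff2_pre \<delta> A =
     (INF C \<in> {C :: nat \<Rightarrow> (real^3) set. A \<subseteq> (\<Union>i. C i) \<and> (\<forall>i. bounded (C i) \<and> diameter (C i) \<le> \<delta>)}.
        (\<Sum>i. ennreal (pi / 4 * (diameter (C i))\<^sup>2)))"

definition hausdorff2 :: "(real^3) set \<Rightarrow> ennreal" where
  "hausdorff2 A = (SUP \<delta>\<in>{0<..}. hausdorff2_pre \<delta> A)"

definition surface_measure :: "(real^3) measure" where
  "surface_measure = measure_of UNIV (sets borel) hausdorff2"

lemma hausdorff2_pre_le:
  assumes "A \<subseteq> (\<Union>i. C i)" "\<And>i. bounded (C i)" "\<And>i. diameter (C i) \<le> \<delta>"
  shows "hausdorff2_pre \<delta> A \<le> (\<Sum>i. ennreal (pi / 4 * (diameter (C i))\<^sup>2))"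
  unfolding hausdorff2_pre_def using assms by (intro INF_lower) auto

lemma hausdorff2_pre_mono: "A \<subseteq> B \<Longrightarrow> hausdorff2_pre \<delta> A \<le> hausdorff2_pre \<delta> B"
  unfolding hausdorff2_pre_def by (rule INF_superset_mono) auto

lemma hausdorff2_pre_antimono: "\<delta> \<le> \<delta>' \<Longrightarrow> hausdorff2_pre \<delta>' A \<le> hausdorff2_pre \<delta> A"
  unfolding hausdorff2_pre_def by (rule INF_superset_mono) (auto intro: order_trans)

lemma hausdorff2_pre_le_hausdorff2: "0 < \<delta> \<Longrightarrow> hausdorff2_pre \<delta> A \<le> hausdorff2 A"
  unfolding hausdorff2_def by (rule SUP_upper) auto

lemma hausdorff2_mono: "A \<subseteq> B \<Longrightarrow> hausdorff2 A \<le> hausdorff2 B"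
  unfolding hausdorff2_def by (rule SUP_mono) (use hausdorff2_pre_mono in blast)

lemma hausdorff2_empty: "hausdorff2 {} = 0"
proof -
  have "hausdorff2_pre \<delta> {} = 0" if "0 < \<delta>" for \<delta>
    using hausdorff2_pre_le[of "{}" "\<lambda>_. {}" \<delta>] that by simp
  then show ?thesis unfolding hausdorff2_def by (simp add: SUP_eqI)
qed

lemma hausdorff2_pre_subadditive: "hausdorff2_pre \<delta> (\<Union>i. A i) \<le> (\<Sum>i. hausdorff2_pre \<delta> (A i))"
proof (rule ennreal_le_epsilon)
  fix e :: real assume e: "0 < e" and fin: "(\<Sum>i. hausdorff2_pre \<delta> (A i)) < top"
  let ?w = "\<lambda>S :: (real^3) set. ennreal (pi / 4 * (diameter S)\<^sup>2)"
  have "\<exists>C. A n \<subseteq> (\<Union>i. C i) \<and> (\<forall>i. bounded (C i) \<and> diameter (C i) \<le> \<delta>) \<and>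
          (\<Sum>i. ?w (C i)) < hausdorff2_pre \<delta> (A n) + e * (1/2)^Suc n" for n
  proof -
    have "hausdorff2_pre \<delta> (A n) < hausdorff2_pre \<delta> (A n) + e * (1/2)^Suc n"
      using e fin ennreal_suminf_lessD[OF fin, of n] by (auto simp: less_top ennreal_zero_less_mult_iff)
    from this[unfolded hausdorff2_pre_def[of \<delta> "A n"] INF_less_iff] show ?thesis
      unfolding hausdorff2_pre_def by auto
  qed
  then obtain C where C: "\<And>n. A n \<subseteq> (\<Union>i. C n i)" "\<And>n i. bounded (C n i)" "\<And>n i. diameter (C n i) \<le> \<delta>"
      "\<And>n. (\<Sum>i. ?w (C n i)) < hausdorff2_pre \<delta> (A n) + e * (1/2)^Suc n"
    by metis
  define D where "D = (\<lambda>m. case prod_decode m of (n, i) \<Rightarrow> C n i)"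
  have "(\<Union>i. A i) \<subseteq> (\<Union>m. D m)"
  proof
    fix x assume "x \<in> (\<Union>i. A i)"
    then obtain n i where "x \<in> C n i" using C(1) by blast
    then have "x \<in> D (prod_encode (n, i))" by (simp add: D_def)
    then show "x \<in> (\<Union>m. D m)" by blast
  qed
  then have "hausdorff2_pre \<delta> (\<Union>i. A i) \<le> (\<Sum>m. ?w (D m))"
    by (rule hausdorff2_pre_le) (auto simp: D_def C split: prod.split)
  also have "\<dots> = (\<Sum>m. (\<lambda>(n, i). ?w (C n i)) (prod_decode m))"
    by (simp add: D_def split_beta)
  also have "\<dots> = (\<Sum>n. \<Sum>i. ?w (C n i))"
    by (rule suminf_ennreal_2dimen[unfolded comp_def]) simp
  also have "\<dots> \<le> (\<Sum>n. hausdorff2_pre \<delta> (A n) + e * (1/2)^Suc n)"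
    using C(4) by (intro suminf_le) (auto simp: less_imp_le)
  also have "\<dots> = (\<Sum>n. hausdorff2_pre \<delta> (A n)) + (\<Sum>n. ennreal e * ennreal ((1/2)^Suc n))"
    using e by (subst suminf_add[symmetric]) (auto simp del: ennreal_suminf_cmult simp: ennreal_mult[symmetric])
  also have "\<dots> = (\<Sum>n. hausdorff2_pre \<delta> (A n)) + ennreal e"
    unfolding ennreal_suminf_cmult
    by (subst suminf_ennreal_eq[OF zero_le_power power_half_series]) auto
  finally show "hausdorff2_pre \<delta> (\<Union>i. A i) \<le> (\<Sum>n. hausdorff2_pre \<delta> (A n)) + ennreal e" .
qed

lemma hausdorff2_subadditive: "hausdorff2 (\<Union>i. A i) \<le> (\<Sum>i. hausdorff2 (A i))"
  unfolding hausdorff2_def[of "\<Union>i. A i"]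
proof (rule SUP_least)
  fix \<delta> :: real assume "\<delta> \<in> {0<..}"
  then have "(\<Sum>i. hausdorff2_pre \<delta> (A i)) \<le> (\<Sum>i. hausdorff2 (A i))"
    by (intro suminf_le) (auto simp: hausdorff2_pre_le_hausdorff2)
  then show "hausdorff2_pre \<delta> (\<Union>i. A i) \<le> (\<Sum>i. hausdorff2 (A i))"
    using hausdorff2_pre_subadditive order_trans by blast
qed

lemma hausdorff2_outer_measure_space: "outer_measure_space (Pow UNIV) hausdorff2"
  unfolding outer_measure_space_def positive_def increasing_def countably_subadditive_def
  by (auto simp: hausdorff2_empty hausdorff2_mono hausdorff2_subadditive)

lemma hausdorff2_Un: "hausdorff2 (A \<union> B) \<le> hausdorff2 A + hausdorff2 B"
proof -
  let ?f = "\<lambda>i::nat. if i = 0 then A else if i = 1 then B else {}"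
  have "(\<Union>i. ?f i) = A \<union> B" by (auto split: if_splits)
  moreover have "(\<Sum>i. hausdorff2 (?f i)) = (\<Sum>i\<in>{0,1}. hausdorff2 (?f i))"
    by (rule suminf_finite) (auto simp: hausdorff2_empty)
  ultimately show ?thesis using hausdorff2_subadditive[of ?f] by simp
qed

lemma hausdorff2_separated:
  assumes e: "0 < e" and sep: "\<And>x y. x \<in> A \<Longrightarrow> y \<in> B \<Longrightarrow> e \<le> dist x y"
  shows "hausdorff2 A + hausdorff2 B \<le> hausdorff2 (A \<union> B)"
proof -
  let ?w = "\<lambda>S :: (real^3) set. ennreal (pi / 4 * (diameter S)\<^sup>2)"
  have pre: "hausdorff2_pre \<delta> A + hausdorff2_pre \<delta> B \<le> hausdorff2_pre \<delta> (A \<union> B)" if d: "0 < \<delta>" "\<delta> < e" for \<delta>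
    unfolding hausdorff2_pre_def[of \<delta> "A \<union> B"]
  proof (rule INF_greatest, clarify)
    fix C :: "nat \<Rightarrow> (real^3) set"
    assume C: "A \<union> B \<subseteq> (\<Union>i. C i)" "\<forall>i. bounded (C i) \<and> diameter (C i) \<le> \<delta>"
    define a where "a i = (if C i \<inter> A = {} then {} else C i)" for i
    define b where "b i = (if C i \<inter> B = {} then {} else C i)" for i
    have ab: "?w (a i) + ?w (b i) \<le> ?w (C i)" for i
    proof (cases "C i \<inter> A \<noteq> {} \<and> C i \<inter> B \<noteq> {}")
      case True
      then obtain x y where "x \<in> C i" "x \<in> A" "y \<in> C i" "y \<in> B" by blast
      then have "e \<le> \<delta>"
        using diameter_bounded_bound[of "C i" x y] C(2) sep[of x y] by (meson order_trans)
      then show ?thesis using d by simp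
    qed (auto simp: a_def b_def)
    have "hausdorff2_pre \<delta> A + hausdorff2_pre \<delta> B \<le> (\<Sum>i. ?w (a i)) + (\<Sum>i. ?w (b i))"
    proof (intro add_mono hausdorff2_pre_le)
      show "A \<subseteq> (\<Union>i. a i)" using C(1) unfolding a_def by fastforce
      show "B \<subseteq> (\<Union>i. b i)" using C(1) unfolding b_def by fastforce
    qed (use C(2) d in \<open>auto simp: a_def b_def\<close>)
    also have "\<dots> = (\<Sum>i. ?w (a i) + ?w (b i))" by (rule suminf_add) auto
    also have "\<dots> \<le> (\<Sum>i. ?w (C i))" by (intro suminf_le ab) auto
    finally show "hausdorff2_pre \<delta> A + hausdorff2_pre \<delta> B \<le> (\<Sum>i. ?w (C i))" .
  qed
  have *: "hausdorff2_pre \<delta> A + hausdorff2_pre \<delta>' B \<le> hausdorff2 (A \<union> B)" if "0 < \<delta>" "0 < \<delta>'" for \<delta> \<delta>'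
  proof -
    define \<eta> where "\<eta> = min (min \<delta> \<delta>') (e / 2)"
    have "hausdorff2_pre \<delta> A + hausdorff2_pre \<delta>' B \<le> hausdorff2_pre \<eta> A + hausdorff2_pre \<eta> B"
      by (intro add_mono hausdorff2_pre_antimono) (auto simp: \<eta>_def)
    also have "\<dots> \<le> hausdorff2_pre \<eta> (A \<union> B)" using that e by (intro pre) (auto simp: \<eta>_def)
    also have "\<dots> \<le> hausdorff2 (A \<union> B)"
      using that e by (intro hausdorff2_pre_le_hausdorff2) (auto simp: \<eta>_def)
    finally show ?thesis .
  qed
  have "hausdorff2_pre \<delta> A + hausdorff2 B \<le> hausdorff2 (A \<union> B)" if "0 < \<delta>" for \<delta>
    unfolding hausdorff2_def[of B]
    by (subst ennreal_SUP_add_right) (use * that in \<open>auto intro!: SUP_least\<close>)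
  then show ?thesis
    unfolding hausdorff2_def[of A]
    by (subst ennreal_SUP_add_left[symmetric]) (auto intro!: SUP_least)
qed

lemma hausdorff2_closed:
  assumes F: "closed F"
  shows "hausdorff2 (A \<inter> F) + hausdorff2 (A - F) \<le> hausdorff2 A"
proof (cases "hausdorff2 A = top \<or> F = {}")
  case True
  then show ?thesis by (auto simp: hausdorff2_empty)
next
  case False
  then have fin: "hausdorff2 A < top" and ne: "F \<noteq> {}" by (auto simp: less_top)
  define S where "S n = {x \<in> A. 1 / real (Suc n) \<le> infdist x F}" for n
  define R where "R n = S (Suc n) - S n" for n
  have S_mono: "S m \<subseteq> S n" if "m \<le> n" for m n
    using that unfolding S_def by (force simp: frac_le intro: order_trans[rotated])
  have sepR: "hausdorff2 P + hausdorff2 (R k) \<le> hausdorff2 (P \<union> R k)"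
    if "P \<subseteq> S m" "m < k" for P m k
  proof (rule hausdorff2_separated)
    show "0 < 1 / real (Suc m) - 1 / real (Suc k)" using that by (simp add: frac_less2)
    fix x y assume "x \<in> P" "y \<in> R k"
    then have "1 / real (Suc m) \<le> infdist x F" "infdist y F < 1 / real (Suc k)"
      using that by (auto simp: S_def R_def)
    then show "1 / real (Suc m) - 1 / real (Suc k) \<le> dist x y"
      using infdist_triangle[of x F y] by linarith
  qed
  have sub: "R k \<subseteq> S (Suc k)" for k by (auto simp: R_def)
  have par: "(\<Sum>k<m. hausdorff2 (R (2*k+j))) \<le> hausdorff2 (\<Union>k<m. R (2*k+j))" for m j
  proof (induction m)
    case (Suc m)
    have *: "(\<Union>k<m. R (2*k+j)) \<subseteq> S (2*m+j-1)"
    proof (rule UN_least)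
      fix k assume "k \<in> {..<m}"
      then have "S (Suc (2*k+j)) \<subseteq> S (2*m+j-1)" by (intro S_mono) auto
      with sub[of "2*k+j"] show "R (2*k+j) \<subseteq> S (2*m+j-1)" by (rule order_trans)
    qed
    have a: "hausdorff2 (\<Union>k<m. R (2*k+j)) + hausdorff2 (R (2*m+j)) \<le>
        hausdorff2 ((\<Union>k<m. R (2*k+j)) \<union> R (2*m+j))"
    proof (cases "m = 0")
      case False
      then show ?thesis by (intro sepR[OF *]) auto
    qed (simp add: hausdorff2_empty)
    have b: "(\<Union>k<Suc m. R (2*k+j)) = (\<Union>k<m. R (2*k+j)) \<union> R (2*m+j)"
      by (auto simp: lessThan_Suc)
    have d: "(\<Sum>k<Suc m. hausdorff2 (R (2*k+j))) \<le> hausdorff2 (\<Union>k<m. R (2*k+j)) + hausdorff2 (R (2*m+j))"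
      using Suc by (simp add: add_right_mono)
    show ?case unfolding b by (rule order_trans[OF d a])
  qed (simp add: hausdorff2_empty)
  have par': "(\<Sum>k<m. hausdorff2 (R (2*k+j))) \<le> hausdorff2 A" for m j
  proof -
    have "(\<Union>k<m. R (2*k+j)) \<subseteq> A" unfolding R_def S_def by blast
    then show ?thesis using par hausdorff2_mono order_trans by blast
  qed
  have "(\<Sum>k<m. hausdorff2 (R k)) \<le> hausdorff2 A + hausdorff2 A" for m
  proof -
    have "(\<Sum>k<m. hausdorff2 (R k)) \<le> (\<Sum>k<2*m. hausdorff2 (R k))"
      by (rule sum_mono2) auto
    also have "\<dots> = (\<Sum>k<m. hausdorff2 (R (2*k+0))) + (\<Sum>k<m. hausdorff2 (R (2*k+1)))"
      by (induction m) (auto simp: algebra_simps)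
    also have "\<dots> \<le> hausdorff2 A + hausdorff2 A" by (intro add_mono par')
    finally show ?thesis .
  qed
  then have "(\<Sum>k. hausdorff2 (R k)) \<le> hausdorff2 A + hausdorff2 A"
    by (intro suminf_le_const) auto
  then have finR: "(\<Sum>k. hausdorff2 (R k)) \<noteq> top" using fin
    by (metis ennreal_add_eq_top less_top neq_top_trans)
  have bound: "hausdorff2 (A \<inter> F) + hausdorff2 (A - F) \<le> hausdorff2 A + (\<Sum>k. hausdorff2 (R (k+n)))" for n
  proof -
    have "A - F \<subseteq> S n \<union> (\<Union>k. R (k+n))"
    proof
      fix x assume x: "x \<in> A - F"
      then have "0 < infdist x F"
        using F ne infdist_pos_not_in_closed by blast
      then obtain p where "1 / real (Suc p) < infdist x F"
        using nat_approx_posE by blast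
      then have "x \<in> S p" using x by (simp add: S_def)
      then have ex: "x \<in> S (p + n)" using S_mono[of p "p+n"] by auto
      have "x \<in> S (q + n) \<Longrightarrow> x \<in> S n \<union> (\<Union>k. R (k+n))" for q
        by (induction q) (auto simp: R_def)
      with ex show "x \<in> S n \<union> (\<Union>k. R (k+n))" by blast
    qed
    then have "hausdorff2 (A - F) \<le> hausdorff2 (S n \<union> (\<Union>k. R (k+n)))" by (rule hausdorff2_mono)
    also have "\<dots> \<le> hausdorff2 (S n) + hausdorff2 (\<Union>k. R (k+n))" by (rule hausdorff2_Un)
    also have "\<dots> \<le> hausdorff2 (S n) + (\<Sum>k. hausdorff2 (R (k+n)))"
      by (intro add_left_mono hausdorff2_subadditive)
    finally have u: "hausdorff2 (A - F) \<le> hausdorff2 (S n) + (\<Sum>k. hausdorff2 (R (k+n)))" .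
    have w: "hausdorff2 (A \<inter> F) + hausdorff2 (S n) \<le> hausdorff2 A"
    proof -
      have "hausdorff2 (A \<inter> F) + hausdorff2 (S n) \<le> hausdorff2 ((A \<inter> F) \<union> S n)"
      proof (rule hausdorff2_separated)
        show "0 < 1 / real (Suc n)" by simp
        fix x y assume "x \<in> A \<inter> F" "y \<in> S n"
        then show "1 / real (Suc n) \<le> dist x y"
          using infdist_le[of x F y] by (auto simp: S_def dist_commute)
      qed
      also have "\<dots> \<le> hausdorff2 A" by (rule hausdorff2_mono) (auto simp: S_def)
      finally show ?thesis .
    qed
    have "hausdorff2 (A \<inter> F) + hausdorff2 (A - F) \<le>
        hausdorff2 (A \<inter> F) + (hausdorff2 (S n) + (\<Sum>k. hausdorff2 (R (k+n))))"
      using u by (rule add_left_mono)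
    also have "\<dots> = (hausdorff2 (A \<inter> F) + hausdorff2 (S n)) + (\<Sum>k. hausdorff2 (R (k+n)))"
      by (simp only: add.assoc)
    also have "\<dots> \<le> hausdorff2 A + (\<Sum>k. hausdorff2 (R (k+n)))"
      using w by (rule add_right_mono)
    finally show ?thesis .
  qed
  have "(\<lambda>n. \<Sum>k. hausdorff2 (R (k+n))) \<longlonglongrightarrow> 0"
  proof -
    obtain f where f: "\<And>k. 0 \<le> f k" "\<And>k. hausdorff2 (R k) = ennreal (f k)"
    proof -
      have "hausdorff2 (R k) < top" for k
        by (rule ennreal_suminf_lessD) (rule finR[unfolded less_top])
      then have "hausdorff2 (R k) = ennreal (enn2real (hausdorff2 (R k)))" for k
        by (rule ennreal_enn2real[symmetric])
      then show ?thesis using that[of "\<lambda>k. enn2real (hausdorff2 (R k))"] enn2real_nonneg by blast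
    qed
    have sf: "summable f" using finR unfolding f(2) by (intro summable_suminf_not_top f(1))
    have "(\<lambda>n. ennreal (\<Sum>k. f (k+n))) \<longlonglongrightarrow> ennreal 0"
      using suminf_exist_split2[OF sf] by (intro tendsto_ennrealI)
    moreover have "(\<Sum>k. hausdorff2 (R (k+n))) = ennreal (\<Sum>k. f (k+n))" for n
      using f sf by (simp add: suminf_ennreal2)
    ultimately show ?thesis by simp
  qed
  then have "(\<lambda>n. hausdorff2 A + (\<Sum>k. hausdorff2 (R (k+n)))) \<longlonglongrightarrow> hausdorff2 A + 0"
    by (intro tendsto_add tendsto_const)
  from LIMSEQ_le_const[OF this] show ?thesis using bound by simp
qed

text \<open>
  The Borel sets are Caratheodory measurable for \<open>hausdorff2\<close>, so
  \<open>measure_of\<close> in the definition above does not fall back to the zero measure.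
\<close>

lemma emeasure_surface_measure:
  assumes "A \<in> sets borel"
  shows "emeasure surface_measure A = hausdorff2 A"
proof -
  let ?L = "lambda_system UNIV (Pow UNIV) hausdorff2"
  interpret P: sigma_algebra UNIV "Pow (UNIV :: (real^3) set)" by (rule sigma_algebra_Pow)
  have L: "measure_space UNIV ?L hausdorff2"
    by (rule P.caratheodory_lemma[OF hausdorff2_outer_measure_space])
  interpret L: sigma_algebra UNIV ?L using L by (simp add: measure_space_def)
  have "F \<in> ?L" if "closed F" for F
  proof -
    have "hausdorff2 (X \<inter> F) + hausdorff2 (X - F) = hausdorff2 X" for X
      using hausdorff2_closed[OF that, of X] hausdorff2_Un[of "X \<inter> F" "X - F"]
      by (simp add: Int_Diff_Un antisym)
    then show ?thesis unfolding P.lambda_system_eq by simp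
  qed
  then have sub: "sets borel \<subseteq> ?L"
    using L.sigma_sets_subset[of "Collect closed"] by (simp add: borel_eq_closed subset_eq del: Pow_UNIV)
  have "countably_additive (sets borel) hausdorff2"
    using L sub unfolding measure_space_def countably_additive_def by blast
  then have "measure_space UNIV (sets borel) hausdorff2"
    using sets.sigma_algebra_axioms[of "borel :: (real^3) measure"] L
    by (auto simp: measure_space_def positive_def)
  then show ?thesis
    unfolding surface_measure_def using assms
    by (intro emeasure_measure_of_sigma) (auto simp: measure_space_def)
qed


section \<open>Surface, mesh and finite element space\<close>

definition level_set_surface ::
  "(real^3) set \<Rightarrow> (real^3 \<Rightarrow> real) \<Rightarrow> (real^3) set \<Rightarrow> bool" where
  "level_set_surface \<Omega> \<phi> \<Gamma> \<longleftrightarrow>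
     open \<Omega> \<and> connected \<Omega> \<and>
     \<Gamma> = {x \<in> \<Omega>. \<phi> x = 0} \<and> \<Gamma> \<noteq> {} \<and> compact \<Gamma> \<and>
     (\<exists>L. L-lipschitz_on (closure \<Omega>) \<phi>) \<and>
     (\<exists>U \<alpha> G. open U \<and> \<Gamma> \<subseteq> U \<and> U \<subseteq> \<Omega> \<and> 0 < \<alpha> \<and> continuous_on U G \<and>
        (\<forall>x\<in>U. GDERIV \<phi> x :> G x \<and> \<alpha> \<le> norm (G x)))"

definition shape_regular :: "real \<Rightarrow> (real^3) set \<Rightarrow> bool" where
  "shape_regular \<sigma> T \<longleftrightarrow> (\<exists>x r. 0 < r \<and> ball x r \<subseteq> T \<and> diameter T \<le> \<sigma> * r)"

definition tetrahedral_mesh ::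
  "(real^3) set \<Rightarrow> (real^3) set set \<Rightarrow> real \<Rightarrow> real \<Rightarrow> bool" where
  "tetrahedral_mesh \<Omega> \<T> \<sigma> h \<longleftrightarrow>
     triangulation \<T> \<and> \<Union>\<T> = closure \<Omega> \<and>
     (\<forall>T\<in>\<T>. 3 simplex T \<and> shape_regular \<sigma> T) \<and>
     h = Max (diameter ` \<T>) \<and> 0 < h"

definition cut_mesh :: "(real^3) set set \<Rightarrow> (real^3) set \<Rightarrow> (real^3) set set" where
  "cut_mesh \<T> \<Gamma> = {T \<in> \<T>. T \<inter> \<Gamma> \<noteq> {}}"

definition P1_on :: "(real^3) set \<Rightarrow> (real^3 \<Rightarrow> real) \<Rightarrow> bool" where
  "P1_on T v \<longleftrightarrow> (\<exists>g b. \<forall>x\<in>T. v x = g \<bullet> x + b)"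

definition P1_interpolant ::
  "(real^3) set set \<Rightarrow> (real^3 \<Rightarrow> real) \<Rightarrow> (real^3 \<Rightarrow> real) \<Rightarrow> bool" where
  "P1_interpolant \<T> \<phi> \<phi>h \<longleftrightarrow>
     (\<forall>T\<in>\<T>. P1_on T \<phi>h \<and> (\<forall>p. p extreme_point_of T \<longrightarrow> \<phi>h p = \<phi> p))"

text \<open>
  From here on \<open>K\<close> is the set of cut tetrahedra and \<open>\<phi>h\<close> the discrete
  level set function.  Finite element functions are total functions of which only the restriction
  to \<open>\<Union>K\<close> matters.
\<close>

definition fe_space :: "(real^3) set set \<Rightarrow> (real^3 \<Rightarrow> real) set" where
  "fe_space K = {v. continuous_on (\<Union>K) v \<and> (\<forall>T\<in>K. P1_on T v)}"

text \<open>
  The gradient of a piecewise affine function is taken elementwise.  At a point shared by several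
  tetrahedra one of them is selected, the same one for all functions.  For integrals over
  \<open>\<Union>K\<close> the choice is irrelevant because the faces are null sets.  If the discrete
  surface contains a face, the adjacent unit normals there agree up to sign, and the adjacent
  tangential gradients agree, so the choice is irrelevant for integrals over the surface as well.
\<close>

definition elem_grad :: "(real^3) set \<Rightarrow> (real^3 \<Rightarrow> real) \<Rightarrow> real^3" where
  "elem_grad T v = (THE g. \<exists>b. \<forall>x\<in>T. v x = g \<bullet> x + b)"

definition elem_at :: "(real^3) set set \<Rightarrow> real^3 \<Rightarrow> (real^3) set" where
  "elem_at K x = (SOME T. T \<in> K \<and> x \<in> T)"

definition fe_grad :: "(real^3) set set \<Rightarrow> (real^3 \<Rightarrow> real) \<Rightarrow> real^3 \<Rightarrow> real^3" where
  "fe_grad K v x = elem_grad (elem_at K x) v"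

definition discrete_surface :: "(real^3) set set \<Rightarrow> (real^3 \<Rightarrow> real) \<Rightarrow> (real^3) set" where
  "discrete_surface K \<phi>h = {x \<in> \<Union>K. \<phi>h x = 0}"

definition discrete_normal :: "(real^3) set set \<Rightarrow> (real^3 \<Rightarrow> real) \<Rightarrow> real^3 \<Rightarrow> real^3" where
  "discrete_normal K \<phi>h x = fe_grad K \<phi>h x /\<^sub>R norm (fe_grad K \<phi>h x)"

definition tangent_proj :: "(real^3) set set \<Rightarrow> (real^3 \<Rightarrow> real) \<Rightarrow> real^3 \<Rightarrow> real^3^3" where
  "tangent_proj K \<phi>h x =
     mat 1 - (\<chi> i j. discrete_normal K \<phi>h x $ i * discrete_normal K \<phi>h x $ j)"

definition surf_grad ::
  "(real^3) set set \<Rightarrow> (real^3 \<Rightarrow> real) \<Rightarrow> (real^3 \<Rightarrow> real) \<Rightarrow> real^3 \<Rightarrow> real^3" where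
  "surf_grad K \<phi>h v x = tangent_proj K \<phi>h x *v fe_grad K v x"

definition normal_deriv ::
  "(real^3) set set \<Rightarrow> (real^3 \<Rightarrow> real) \<Rightarrow> (real^3 \<Rightarrow> real) \<Rightarrow> real^3 \<Rightarrow> real" where
  "normal_deriv K \<phi>h v x = discrete_normal K \<phi>h x \<bullet> fe_grad K v x"

definition surf_ip ::
  "(real^3) set set \<Rightarrow> (real^3 \<Rightarrow> real) \<Rightarrow> (real^3 \<Rightarrow> 'a::real_inner) \<Rightarrow> (real^3 \<Rightarrow> 'a) \<Rightarrow> real" where
  "surf_ip K \<phi>h u w = (LINT x : discrete_surface K \<phi>h | surface_measure. u x \<bullet> w x)"

definition surf_norm ::
  "(real^3) set set \<Rightarrow> (real^3 \<Rightarrow> real) \<Rightarrow> (real^3 \<Rightarrow> 'a::real_inner) \<Rightarrow> real" where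
  "surf_norm K \<phi>h u = sqrt (surf_ip K \<phi>h u u)"

definition bulk_ip :: "(real^3) set set \<Rightarrow> (real^3 \<Rightarrow> real) \<Rightarrow> (real^3 \<Rightarrow> real) \<Rightarrow> real" where
  "bulk_ip K u w = (LINT x : \<Union>K | lborel. u x * w x)"

definition bulk_norm :: "(real^3) set set \<Rightarrow> (real^3 \<Rightarrow> real) \<Rightarrow> real" where
  "bulk_norm K u = sqrt (bulk_ip K u u)"


section \<open>The SAV schemes\<close>

definition f0 :: "real \<Rightarrow> real" where
  "f0 c = 1 / 4 * c\<^sup>2 * (1 - c)\<^sup>2"

text \<open>There is no cut-off: the mobility is negative outside \<open>{0..1}\<close>.\<close>

definition mobility :: "real \<Rightarrow> real" where
  "mobility c = c * (1 - c)"

definition E1 :: "(real^3) set \<Rightarrow> (real^3 \<Rightarrow> real) \<Rightarrow> real" where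
  "E1 \<Gamma> c = (LINT x : \<Gamma> | surface_measure. f0 (c x))"

text \<open>
  In the two step predicates the surface \<open>\<Gamma>\<close> enters only through \<open>E1\<close>;
  all inner products are over the discrete surface.
\<close>

definition sav_bdf1_step ::
  "(real^3) set \<Rightarrow> (real^3) set set \<Rightarrow> (real^3 \<Rightarrow> real) \<Rightarrow> real \<Rightarrow> real \<Rightarrow> real \<Rightarrow> real \<Rightarrow>
   (real^3 \<Rightarrow> real) \<Rightarrow> real \<Rightarrow> (real^3 \<Rightarrow> real) \<Rightarrow> (real^3 \<Rightarrow> real) \<Rightarrow> real \<Rightarrow> bool" where
  "sav_bdf1_step \<Gamma> K \<phi>h h \<rho> \<epsilon> \<Delta>t c_old r_old c_new \<mu>_new r_new \<longleftrightarrow>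
     (\<forall>v\<in>fe_space K. \<forall>q\<in>fe_space K.
        \<rho> * surf_ip K \<phi>h (\<lambda>x. c_new x - c_old x) v =
          - \<Delta>t * surf_ip K \<phi>h (\<lambda>x. mobility (c_old x) *\<^sub>R surf_grad K \<phi>h \<mu>_new x) (surf_grad K \<phi>h v)
          - h * \<Delta>t * bulk_ip K (normal_deriv K \<phi>h \<mu>_new) (normal_deriv K \<phi>h v) \<and>
        surf_ip K \<phi>h \<mu>_new q =
          r_new / sqrt (E1 \<Gamma> c_old) * surf_ip K \<phi>h (\<lambda>x. deriv f0 (c_old x)) q
          + \<epsilon>\<^sup>2 * surf_ip K \<phi>h (surf_grad K \<phi>h c_new) (surf_grad K \<phi>h q)
          + inverse h * \<epsilon>\<^sup>2 * bulk_ip K (normal_deriv K \<phi>h c_new) (normal_deriv K \<phi>h q)) \<and>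
     r_new - r_old =
       1 / (2 * sqrt (E1 \<Gamma> c_old)) * surf_ip K \<phi>h (\<lambda>x. deriv f0 (c_old x)) (\<lambda>x. c_new x - c_old x)"

definition extrap :: "(nat \<Rightarrow> real^3 \<Rightarrow> real) \<Rightarrow> nat \<Rightarrow> real^3 \<Rightarrow> real" where
  "extrap c n x = 2 * c n x - c (n - 1) x"

definition sav_bdf2_step ::
  "(real^3) set \<Rightarrow> (real^3) set set \<Rightarrow> (real^3 \<Rightarrow> real) \<Rightarrow> real \<Rightarrow> real \<Rightarrow> real \<Rightarrow> real \<Rightarrow>
   (nat \<Rightarrow> real^3 \<Rightarrow> real) \<Rightarrow> (nat \<Rightarrow> real^3 \<Rightarrow> real) \<Rightarrow> (nat \<Rightarrow> real) \<Rightarrow> nat \<Rightarrow> bool" where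
  "sav_bdf2_step \<Gamma> K \<phi>h h \<rho> \<epsilon> \<Delta>t c \<mu> r n \<longleftrightarrow>
     (\<forall>v\<in>fe_space K. \<forall>q\<in>fe_space K.
        \<rho> / (2 * \<Delta>t) * surf_ip K \<phi>h (\<lambda>x. 3 * c (n+1) x - 4 * c n x + c (n-1) x) v =
          - surf_ip K \<phi>h (\<lambda>x. mobility (extrap c n x) *\<^sub>R surf_grad K \<phi>h (\<mu> (n+1)) x) (surf_grad K \<phi>h v)
          - h * bulk_ip K (normal_deriv K \<phi>h (\<mu> (n+1))) (normal_deriv K \<phi>h v) \<and>
        surf_ip K \<phi>h (\<mu> (n+1)) q =
          r (n+1) / sqrt (E1 \<Gamma> (extrap c n)) * surf_ip K \<phi>h (\<lambda>x. deriv f0 (extrap c n x)) q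
          + \<epsilon>\<^sup>2 * surf_ip K \<phi>h (surf_grad K \<phi>h (c (n+1))) (surf_grad K \<phi>h q)
          + inverse h * \<epsilon>\<^sup>2 * bulk_ip K (normal_deriv K \<phi>h (c (n+1))) (normal_deriv K \<phi>h q)) \<and>
     3 * r (n+1) - 4 * r n + r (n-1) =
       1 / (2 * sqrt (E1 \<Gamma> (extrap c n))) *
         surf_ip K \<phi>h (\<lambda>x. deriv f0 (extrap c n x)) (\<lambda>x. 3 * c (n+1) x - 4 * c n x + c (n-1) x)"

text \<open>
  A run of the scheme.  \<open>E1\<close> vanishes at the constant functions 0 and 1, so its
  positivity can only be required at the functions where the scheme evaluates it.
  \<open>\<mu> 0\<close> is not constrained.
\<close>

definition sav_bdf2_scheme ::
  "(real^3) set \<Rightarrow> (real^3) set set \<Rightarrow> (real^3 \<Rightarrow> real) \<Rightarrow> real \<Rightarrow> real \<Rightarrow> real \<Rightarrow> real \<Rightarrow>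
   (real^3 \<Rightarrow> real) \<Rightarrow> (nat \<Rightarrow> real^3 \<Rightarrow> real) \<Rightarrow> (nat \<Rightarrow> real^3 \<Rightarrow> real) \<Rightarrow> (nat \<Rightarrow> real) \<Rightarrow> bool" where
  "sav_bdf2_scheme \<Gamma> K \<phi>h h \<rho> \<epsilon> \<Delta>t c_init c \<mu> r \<longleftrightarrow>
     (\<forall>n. c n \<in> fe_space K) \<and> (\<forall>n\<ge>1. \<mu> n \<in> fe_space K) \<and>
     continuous_on \<Gamma> c_init \<and> 0 < E1 \<Gamma> c_init \<and> r 0 = sqrt (E1 \<Gamma> c_init) \<and>
     0 < E1 \<Gamma> (c 0) \<and> (\<forall>n\<ge>1. 0 < E1 \<Gamma> (extrap c n)) \<and>
     sav_bdf1_step \<Gamma> K \<phi>h h \<rho> \<epsilon> \<Delta>t (c 0) (r 0) (c 1) (\<mu> 1) (r 1) \<and>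
     (\<forall>n\<ge>1. sav_bdf2_step \<Gamma> K \<phi>h h \<rho> \<epsilon> \<Delta>t c \<mu> r n)"

text \<open>The modified energy at time level \<open>m\<close>, meaningful for \<open>m \<ge> 1\<close> only.\<close>

definition mod_energy ::
  "(real^3) set set \<Rightarrow> (real^3 \<Rightarrow> real) \<Rightarrow> real \<Rightarrow> real \<Rightarrow>
   (nat \<Rightarrow> real^3 \<Rightarrow> real) \<Rightarrow> (nat \<Rightarrow> real) \<Rightarrow> nat \<Rightarrow> real" where
  "mod_energy K \<phi>h h \<epsilon> c r m =
     \<epsilon>\<^sup>2 / 2 * (surf_norm K \<phi>h (surf_grad K \<phi>h (c m)))\<^sup>2
     + \<epsilon>\<^sup>2 / 2 * (surf_norm K \<phi>h (\<lambda>x. 2 *\<^sub>R surf_grad K \<phi>h (c m) x - surf_grad K \<phi>h (c (m-1)) x))\<^sup>2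
     + \<bar>r m\<bar>\<^sup>2 + \<bar>2 * r m - r (m-1)\<bar>\<^sup>2
     + inverse h * \<epsilon>\<^sup>2 / 2 * (bulk_norm K (normal_deriv K \<phi>h (c m)))\<^sup>2
     + inverse h * \<epsilon>\<^sup>2 / 2 * (bulk_norm K (normal_deriv K \<phi>h (\<lambda>x. 2 * c m x - c (m-1) x)))\<^sup>2"

end

theory Submission
  imports Defs
begin

text \<open>
  The energy balance is an algebraic consequence of the scheme.  Testing its first equation with
  the new chemical potential and the second one with the BDF2 difference
  \<open>3a - 4b + c\<close> of three successive concentrations \<open>a\<close> (newest),
  \<open>b\<close>, \<open>c\<close>, and
  eliminating the common term, leaves the dissipation on one side and on the other side the
  energy products of \<open>a\<close> with \<open>3a - 4b + c\<close>.  In any inner product space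
  \<open>2 \<langle>a, 3a - 4b + c\<rangle> =
    |a|\<^sup>2 + |2a - b|\<^sup>2 - |b|\<^sup>2 - |2b - c|\<^sup>2 + |a - 2b + c|\<^sup>2\<close>,
  a difference of energies plus a square.  The identity is used for surface gradients, for normal
  derivatives in the bulk, and for the auxiliary variable, where the update of \<open>r\<close> turns
  the nonlinear term into \<open>2 r\<close> times the BDF2 difference of \<open>r\<close>
  (\<open>sav_bdf2_step_energy_balance\<close>).  Where the mobility is nonnegative the dissipation has a
  sign and stability follows.

  What remains is to justify this algebra under the integral sign
  (\<open>bdf2_integral_identity\<close>), which takes two facts.
  Gradients must be linear in the finite element function: on a tetrahedron with interior
  points an affine function determines its gradient (\<open>fe_grad_lincomb\<close>).
  And the integrands in these identities must be integrable.  Each of them depends on the point only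
  through the tetrahedron that contains it, so it is a Borel function with finitely many values, and
  it suffices that the domain has finite measure (\<open>set_integrable_elementwise\<close>).
  For the bulk this is compactness.  The discrete surface is
  a finite union of bounded planar pieces, and a bounded planar set has finite
  two-dimensional Hausdorff measure (\<open>hausdorff2_finite_planar\<close>).
\<close>

section \<open>Elementwise gradients\<close>

lemma elem_grad_eq:
  assumes int: "interior T \<noteq> {}" and v: "\<forall>x\<in>T. v x = g \<bullet> x + b"
  shows "elem_grad T v = g"
  unfolding elem_grad_def
proof (rule the_equality)
  show "\<exists>b. \<forall>x\<in>T. v x = g \<bullet> x + b" using v by blast
next
  fix g' assume "\<exists>b. \<forall>x\<in>T. v x = g' \<bullet> x + b"
  then obtain b' where v': "\<forall>x\<in>T. v x = g' \<bullet> x + b'" by blast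
  obtain y s where s: "0 < s" "ball y s \<subseteq> T"
    using int by (metis all_not_in_conv mem_interior)
  \<comment> \<open>Move from an interior point in the direction \<open>g' - g\<close>, by less than the radius
    \<open>s\<close>; the 1 keeps the denominator positive when the gradients agree.\<close>
  define t where "t = s / (2 * (1 + norm (g' - g)))"
  have pos: "0 < 1 + norm (g' - g)" by (simp add: add_pos_nonneg)
  then have t: "0 < t" using s(1) by (simp add: t_def)
  have "t * norm (g' - g) < s"
  proof -
    have "t * norm (g' - g) < t * (2 * (1 + norm (g' - g)))"
    proof (rule mult_strict_left_mono[OF _ t])
      show "norm (g' - g) < 2 * (1 + norm (g' - g))"
        using norm_ge_zero[of "g' - g"] by (simp add: distrib_left add_strict_increasing2)
    qed
    also have "\<dots> = s" using pos by (simp add: t_def)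
    finally show ?thesis .
  qed
  then have "y + t *\<^sub>R (g' - g) \<in> T"
    using s t by (intro subsetD[OF s(2)]) (simp add: dist_norm)
  moreover have "y \<in> T" using s by auto
  ultimately have "g \<bullet> (y + t *\<^sub>R (g' - g)) + b = g' \<bullet> (y + t *\<^sub>R (g' - g)) + b'"
      "g \<bullet> y + b = g' \<bullet> y + b'"
    using v v' by metis+
  then have "t * ((g' - g) \<bullet> (g' - g)) = 0"
    by (simp add: inner_add_right inner_diff_left inner_diff_right algebra_simps)
  then show "g' = g" using t by simp
qed

lemma P1_on_elem_grad:
  assumes "interior T \<noteq> {}" and "P1_on T v"
  obtains b where "\<forall>x\<in>T. v x = elem_grad T v \<bullet> x + b"
  using assms elem_grad_eq unfolding P1_on_def by metis

lemma P1_on_lincomb: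
  assumes "P1_on T u" and "P1_on T v"
  shows "P1_on T (\<lambda>x. \<alpha> * u x + \<beta> * v x)"
proof -
  obtain g b g' b' where "\<forall>x\<in>T. u x = g \<bullet> x + b" "\<forall>x\<in>T. v x = g' \<bullet> x + b'"
    using assms unfolding P1_on_def by blast
  then have "\<forall>x\<in>T. \<alpha> * u x + \<beta> * v x = (\<alpha> *\<^sub>R g + \<beta> *\<^sub>R g') \<bullet> x + (\<alpha> * b + \<beta> * b')"
    by (simp add: inner_add_left algebra_simps)
  then show ?thesis unfolding P1_on_def by blast
qed

lemma elem_grad_lincomb:
  assumes T: "interior T \<noteq> {}" and "P1_on T u" and "P1_on T v"
  shows "elem_grad T (\<lambda>x. \<alpha> * u x + \<beta> * v x) = \<alpha> *\<^sub>R elem_grad T u + \<beta> *\<^sub>R elem_grad T v"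
proof -
  obtain b b' where "\<forall>x\<in>T. u x = elem_grad T u \<bullet> x + b" "\<forall>x\<in>T. v x = elem_grad T v \<bullet> x + b'"
    using assms P1_on_elem_grad by metis
  then have "\<forall>x\<in>T. \<alpha> * u x + \<beta> * v x =
      (\<alpha> *\<^sub>R elem_grad T u + \<beta> *\<^sub>R elem_grad T v) \<bullet> x + (\<alpha> * b + \<beta> * b')"
    by (simp add: inner_add_left algebra_simps)
  then show ?thesis by (rule elem_grad_eq[OF T])
qed

lemma fe_space_lincomb:
  assumes "u \<in> fe_space K" and "v \<in> fe_space K"
  shows "(\<lambda>x. \<alpha> * u x + \<beta> * v x) \<in> fe_space K"
  using assms unfolding fe_space_def
  by (auto intro!: continuous_intros P1_on_lincomb)

lemma elem_at_mem:
  assumes "x \<in> \<Union>K"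
  shows "elem_at K x \<in> K" "x \<in> elem_at K x"
proof -
  have "\<exists>T. T \<in> K \<and> x \<in> T" using assms by blast
  then have "elem_at K x \<in> K \<and> x \<in> elem_at K x" unfolding elem_at_def by (rule someI_ex)
  then show "elem_at K x \<in> K" "x \<in> elem_at K x" by auto
qed

lemma fe_grad_lincomb:
  assumes "\<forall>T\<in>K. interior T \<noteq> {}" and "u \<in> fe_space K" and "v \<in> fe_space K" and "x \<in> \<Union>K"
  shows "fe_grad K (\<lambda>x. \<alpha> * u x + \<beta> * v x) x = \<alpha> *\<^sub>R fe_grad K u x + \<beta> *\<^sub>R fe_grad K v x"
  using assms elem_at_mem[of x K] unfolding fe_grad_def fe_space_def
  by (intro elem_grad_lincomb) auto

section \<open>Finite area of the discrete surface\<close>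

lemma hausdorff2_pre_le_finite_cover:
  assumes "finite I" and cover: "A \<subseteq> (\<Union>i\<in>I. C i)"
    and bd: "\<And>i. i \<in> I \<Longrightarrow> bounded (C i)" and diam: "\<And>i. i \<in> I \<Longrightarrow> diameter (C i) \<le> d"
    and d: "0 \<le> d" "d \<le> \<delta>"
  shows "hausdorff2_pre \<delta> A \<le> ennreal (real (card I) * (pi / 4 * d\<^sup>2))"
proof -
  obtain e where e: "bij_betw e {..<card I} I"
    using \<open>finite I\<close> ex_bij_betw_nat_finite[of I] by (auto simp: atLeast0LessThan)
  define D where "D = (\<lambda>n. if n < card I then C (e n) else {})"
  have eI: "e n \<in> I" if "n < card I" for n
    using e that by (auto simp: bij_betw_def)
  have "A \<subseteq> (\<Union>n. D n)"
  proof
    fix x assume "x \<in> A"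
    then obtain i where "i \<in> I" "x \<in> C i" using cover by blast
    moreover have "i \<in> e ` {..<card I}" using e \<open>i \<in> I\<close> by (simp add: bij_betw_def)
    ultimately show "x \<in> (\<Union>n. D n)" by (force simp: D_def)
  qed
  then have "hausdorff2_pre \<delta> A \<le> (\<Sum>n. ennreal (pi / 4 * (diameter (D n))\<^sup>2))"
    using bd order_trans[OF diam d(2)] d eI by (intro hausdorff2_pre_le) (auto simp: D_def)
  also have "\<dots> = (\<Sum>n<card I. ennreal (pi / 4 * (diameter (D n))\<^sup>2))"
    by (rule suminf_finite) (auto simp: D_def)
  also have "\<dots> \<le> (\<Sum>n<card I. ennreal (pi / 4 * d\<^sup>2))"
    using bd diam eI
    by (intro sum_mono ennreal_leI mult_left_mono power_mono) (auto simp: D_def diameter_ge_0)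
  also have "\<dots> = ennreal (real (card I) * (pi / 4 * d\<^sup>2))"
    by (simp add: ennreal_mult'' ennreal_of_nat_eq_real_of_nat del: times_divide_eq_left times_divide_eq_right)
  finally show ?thesis .
qed

lemma same_floor_abs_diff_le:
  fixes a b s :: real
  assumes "0 < s" and "\<lfloor>a / s\<rfloor> = \<lfloor>b / s\<rfloor>"
  shows "\<bar>a - b\<bar> \<le> s"
proof -
  have "\<bar>a / s - b / s\<bar> \<le> 1" using assms(2) by linarith
  then show ?thesis using assms(1) by (simp add: diff_divide_distrib[symmetric] abs_divide)
qed

text \<open>
  A grid argument: sorting the points by two of their coordinates on a grid of mesh \<open>R / N\<close>
  gives at most \<open>(2N + 1)\<^sup>2\<close> pieces of diameter at most \<open>2 L R / N\<close>,
  so the sum of the squared diameters stays bounded as \<open>N\<close> grows.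
\<close>

lemma hausdorff2_finite_two_coordinates:
  fixes A :: "(real^3) set"
  assumes "bounded A"
    and lip: "\<And>x y. x \<in> A \<Longrightarrow> y \<in> A \<Longrightarrow> norm (x - y) \<le> L * (\<bar>x$j - y$j\<bar> + \<bar>x$k - y$k\<bar>)"
    and L: "0 < L"
  shows "hausdorff2 A < \<infinity>"
proof -
  obtain R where R: "0 < R" "\<And>x. x \<in> A \<Longrightarrow> norm x \<le> R"
    using \<open>bounded A\<close> by (auto simp: bounded_pos)
  have "hausdorff2_pre \<delta> A \<le> ennreal (9 * pi * L\<^sup>2 * R\<^sup>2)" if \<delta>: "0 < \<delta>" for \<delta>
  proof -
    obtain N' :: nat where N': "2 * L * R / \<delta> < real N'" using reals_Archimedean2 by blast
    define N where "N = Suc N'"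
    define s where "s = R / real N"
    have N: "1 \<le> real N" "2 * L * R / \<delta> \<le> real N" using N' by (auto simp: N_def)
    have s: "0 < s" using R N by (simp add: s_def)
    have d: "2 * L * s \<le> \<delta>"
      using N \<delta> by (simp add: s_def field_simps)
    define I where "I = {- int N..int N} \<times> {- int N..int N}"
    define C where "C = (\<lambda>(p, q). {x \<in> A. \<lfloor>x$j / s\<rfloor> = p \<and> \<lfloor>x$k / s\<rfloor> = q})"
    have range: "\<lfloor>x$i / s\<rfloor> \<in> {- int N..int N}" if "x \<in> A" for x i
    proof -
      have "\<bar>x$i\<bar> \<le> R" using R(2)[OF that] component_le_norm_cart[of x i] by linarith
      then have "\<bar>x$i / s\<bar> \<le> real N"
        using R N s by (simp add: s_def abs_divide abs_mult field_simps)
      then have "- real N \<le> x$i / s" "x$i / s \<le> real N" by linarith+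
      then show ?thesis by (auto simp: le_floor_iff floor_le_iff)
    qed
    have "hausdorff2_pre \<delta> A \<le> ennreal (real (card I) * (pi / 4 * (2 * L * s)\<^sup>2))"
    proof (rule hausdorff2_pre_le_finite_cover[where C = C])
      show "finite I" by (simp add: I_def)
      show "A \<subseteq> (\<Union>i\<in>I. C i)" using range by (auto simp: C_def I_def)
      fix i assume "i \<in> I"
      show "bounded (C i)" by (rule bounded_subset[OF \<open>bounded A\<close>]) (auto simp: C_def split: prod.split)
      show "diameter (C i) \<le> 2 * L * s"
      proof (rule diameter_le)
        show "C i \<noteq> {} \<or> 0 \<le> 2 * L * s" using L s by simp
        fix x y assume xy: "x \<in> C i" "y \<in> C i"
        then have "\<bar>x$j - y$j\<bar> \<le> s" "\<bar>x$k - y$k\<bar> \<le> s"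
          by (auto simp: C_def split: prod.splits intro!: same_floor_abs_diff_le[OF s])
        then have "L * (\<bar>x$j - y$j\<bar> + \<bar>x$k - y$k\<bar>) \<le> L * (s + s)"
          using L by (intro mult_left_mono) auto
        moreover have "norm (x - y) \<le> L * (\<bar>x$j - y$j\<bar> + \<bar>x$k - y$k\<bar>)"
          using xy by (intro lip) (auto simp: C_def split: prod.splits)
        ultimately show "norm (x - y) \<le> 2 * L * s" by (simp add: algebra_simps)
      qed
    qed (use L s d in auto)
    also have "\<dots> \<le> ennreal (9 * pi * L\<^sup>2 * R\<^sup>2)"
    proof (rule ennreal_leI)
      have "real (card I) = (2 * real N + 1)\<^sup>2"
        by (simp add: I_def card_cartesian_product power2_eq_square nat_add_distrib algebra_simps)
      also have "\<dots> \<le> (3 * real N)\<^sup>2" using N by (intro power_mono) auto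
      finally have "real (card I) * (pi / 4 * (2 * L * s)\<^sup>2) \<le> (3 * real N)\<^sup>2 * (pi / 4 * (2 * L * s)\<^sup>2)"
        by (intro mult_right_mono) auto
      also have "\<dots> = 9 * pi * L\<^sup>2 * (real N * s)\<^sup>2" by (simp add: power2_eq_square)
      also have "real N * s = R" using N by (simp add: s_def)
      finally show "real (card I) * (pi / 4 * (2 * L * s)\<^sup>2) \<le> 9 * pi * L\<^sup>2 * R\<^sup>2" .
    qed
    finally show ?thesis .
  qed
  then have "hausdorff2 A \<le> ennreal (9 * pi * L\<^sup>2 * R\<^sup>2)"
    unfolding hausdorff2_def by (intro SUP_least) auto
  then show ?thesis by (simp add: order_le_less_trans)
qed

text \<open>
  If the \<open>i\<close>-th entry of the normal \<open>g\<close> is nonzero, the equation of the plane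
  controls the \<open>i\<close>-th coordinate by the other two.
\<close>

lemma hausdorff2_finite_planar:
  fixes A :: "(real^3) set"
  assumes "bounded A" and plane: "\<And>x. x \<in> A \<Longrightarrow> g \<bullet> x + b = 0" and "g \<noteq> 0"
  shows "hausdorff2 A < \<infinity>"
proof -
  obtain i where gi: "g$i \<noteq> 0" using \<open>g \<noteq> 0\<close> by (auto simp: vec_eq_iff)
  obtain j k where sum3: "\<And>f :: 3 \<Rightarrow> real. (\<Sum>l\<in>UNIV. f l) = f i + f j + f k"
  proof -
    consider "i = 1" | "i = 2" | "i = 3" using exhaust_3 by blast
    then show ?thesis
    proof cases
      case 1
      then show ?thesis by (intro that[of 2 3]) (simp add: sum_3)
    next
      case 2
      then show ?thesis by (intro that[of 1 3]) (simp add: sum_3)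
    next
      case 3
      then show ?thesis by (intro that[of 1 2]) (simp add: sum_3)
    qed
  qed
  let ?m = "(\<bar>g$j\<bar> + \<bar>g$k\<bar>) / \<bar>g$i\<bar>"
  show ?thesis
  proof (rule hausdorff2_finite_two_coordinates[OF \<open>bounded A\<close>, of "1 + ?m" j k])
    show "0 < 1 + ?m" using gi by (intro add_pos_nonneg) auto
    fix x y assume "x \<in> A" "y \<in> A"
    then have "g \<bullet> (x - y) = 0" using plane[of x] plane[of y] by (simp add: inner_diff_right)
    then have "g$i * (x - y)$i = - (g$j * (x - y)$j + g$k * (x - y)$k)"
      unfolding inner_vec_def sum3 by simp
    then have "\<bar>g$i\<bar> * \<bar>(x - y)$i\<bar> = \<bar>g$j * (x - y)$j + g$k * (x - y)$k\<bar>"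
      by (metis abs_minus_cancel abs_mult)
    also have "\<dots> \<le> \<bar>g$j\<bar> * \<bar>(x - y)$j\<bar> + \<bar>g$k\<bar> * \<bar>(x - y)$k\<bar>"
      by (metis abs_mult abs_triangle_ineq)
    also have "\<dots> \<le> (\<bar>g$j\<bar> + \<bar>g$k\<bar>) * (\<bar>(x - y)$j\<bar> + \<bar>(x - y)$k\<bar>)"
      by (simp add: algebra_simps)
    finally have "\<bar>(x - y)$i\<bar> \<le> ?m * (\<bar>(x - y)$j\<bar> + \<bar>(x - y)$k\<bar>)"
      using gi by (simp add: pos_le_divide_eq mult.commute)
    moreover have "norm (x - y) \<le> \<bar>(x - y)$i\<bar> + \<bar>(x - y)$j\<bar> + \<bar>(x - y)$k\<bar>"
      using norm_le_l1_cart[of "x - y"] unfolding sum3 .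
    ultimately show "norm (x - y) \<le> (1 + ?m) * (\<bar>x$j - y$j\<bar> + \<bar>x$k - y$k\<bar>)"
      by (simp add: distrib_right)
  qed
qed

lemma hausdorff2_finite_UN:
  assumes "finite I" and "\<And>i. i \<in> I \<Longrightarrow> hausdorff2 (C i) < \<infinity>"
  shows "hausdorff2 (\<Union>i\<in>I. C i) < \<infinity>"
  using assms
proof (induction I rule: finite_induct)
  case (insert i I)
  have "hausdorff2 (C i) + hausdorff2 (\<Union>i\<in>I. C i) < \<infinity>"
    using insert by (simp add: ennreal_add_less_top)
  with hausdorff2_Un[of "C i" "\<Union>i\<in>I. C i"] show ?case
    by (auto intro: order_le_less_trans)
qed (simp add: hausdorff2_empty)

lemma discrete_surface_closed_finite:
  assumes "finite K" and "\<And>T. T \<in> K \<Longrightarrow> compact T" and "\<And>T. T \<in> K \<Longrightarrow> interior T \<noteq> {}"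
    and "\<And>T. T \<in> K \<Longrightarrow> P1_on T \<phi>h" and "\<And>T. T \<in> K \<Longrightarrow> elem_grad T \<phi>h \<noteq> 0"
  shows "closed (discrete_surface K \<phi>h)" and "hausdorff2 (discrete_surface K \<phi>h) < \<infinity>"
proof -
  have eq: "discrete_surface K \<phi>h = (\<Union>T\<in>K. {x \<in> T. \<phi>h x = 0})"
    unfolding discrete_surface_def by blast
  have *: "closed {x \<in> T. \<phi>h x = 0} \<and> hausdorff2 {x \<in> T. \<phi>h x = 0} < \<infinity>" if T: "T \<in> K" for T
  proof -
    obtain b where b: "\<forall>x\<in>T. \<phi>h x = elem_grad T \<phi>h \<bullet> x + b"
      by (rule P1_on_elem_grad[OF assms(3)[OF T] assms(4)[OF T]])
    then have "{x \<in> T. \<phi>h x = 0} = T \<inter> {x. elem_grad T \<phi>h \<bullet> x = - b}" by auto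
    then have "closed {x \<in> T. \<phi>h x = 0}"
      using assms(2)[OF T] by (simp add: closed_Int compact_imp_closed closed_hyperplane)
    moreover have "hausdorff2 {x \<in> T. \<phi>h x = 0} < \<infinity>"
    proof (rule hausdorff2_finite_planar[OF _ _ assms(5)[OF T]])
      show "bounded {x \<in> T. \<phi>h x = 0}"
        using assms(2)[OF T] by (intro bounded_subset[OF compact_imp_bounded]) auto
      show "elem_grad T \<phi>h \<bullet> x + b = 0" if "x \<in> {x \<in> T. \<phi>h x = 0}" for x
        using b that by auto
    qed
    ultimately show ?thesis ..
  qed
  show "closed (discrete_surface K \<phi>h)" unfolding eq using * \<open>finite K\<close> by (intro closed_UN) auto
  show "hausdorff2 (discrete_surface K \<phi>h) < \<infinity>"
    unfolding eq using * \<open>finite K\<close> by (intro hausdorff2_finite_UN) auto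
qed

section \<open>Integrals of elementwise constant functions\<close>

text \<open>
  The selected tetrahedron depends on the point only through the set of all tetrahedra that
  contain it.  That set takes finitely many values, each on a Borel set, so every function of it,
  however irregular the selection, is measurable.
\<close>

lemma elem_at_measurable:
  assumes "finite K" and "\<And>T. T \<in> K \<Longrightarrow> closed T"
  shows "(\<lambda>x. \<Phi> (elem_at K x) :: real) \<in> borel_measurable borel"
proof -
  let ?p = "\<lambda>x. {T \<in> K. x \<in> T}"
  have "?p \<in> borel \<rightarrow>\<^sub>M count_space (Pow K)"
  proof (rule measurable_count_space_eq2[THEN iffD2])
    show "finite (Pow K)" using \<open>finite K\<close> by simp
    have "?p -` {P} \<inter> space borel \<in> sets borel" if "P \<in> Pow K" for P
    proof -
      have "?p -` {P} \<inter> space borel = (\<Inter>T\<in>K. if T \<in> P then T else - T)"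
        using that by (auto split: if_splits)
      also have "\<dots> \<in> sets borel"
      proof (cases "K = {}")
        case False
        then show ?thesis
          using \<open>finite K\<close> assms(2) by (intro sets.finite_INT) auto
      qed simp
      finally show ?thesis .
    qed
    then show "?p \<in> space borel \<rightarrow> Pow K \<and> (\<forall>a\<in>Pow K. ?p -` {a} \<inter> space borel \<in> sets borel)"
      by auto
  qed
  then have "(\<lambda>x. (\<lambda>P. \<Phi> (SOME T. T \<in> P)) (?p x)) \<in> borel_measurable borel"
    by (rule measurable_compose) simp
  then show ?thesis unfolding elem_at_def by simp
qed

lemma set_integrable_elementwise:
  fixes \<Phi> :: "(real^3) set \<Rightarrow> real"
  assumes "finite K" and "\<And>T. T \<in> K \<Longrightarrow> closed T"
    and M: "sets M = sets borel" and S: "S \<in> sets borel" "S \<subseteq> \<Union>K" "emeasure M S < \<infinity>"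
  shows "set_integrable M S (\<lambda>x. \<Phi> (elem_at K x))"
  unfolding set_integrable_def
proof (rule integrableI_bounded_set_indicator[where B = "Max ((\<lambda>T. \<bar>\<Phi> T\<bar>) ` K)"])
  show "(\<lambda>x. \<Phi> (elem_at K x)) \<in> borel_measurable M"
    using elem_at_measurable[OF assms(1,2)] M by (simp cong: measurable_cong_sets)
  have "norm (\<Phi> (elem_at K x)) \<le> Max ((\<lambda>T. \<bar>\<Phi> T\<bar>) ` K)" if "x \<in> S" for x
    using elem_at_mem(1)[of x K] that S(2) \<open>finite K\<close> by (auto intro!: Max_ge)
  then show "AE x in M. x \<in> S \<longrightarrow> norm (\<Phi> (elem_at K x)) \<le> Max ((\<lambda>T. \<bar>\<Phi> T\<bar>) ` K)"
    by simp
qed (use M S in auto)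

text \<open>
  The pointwise identity expands into five squares, which have to be integrated separately; the
  hypothesis on \<open>e\<close> is the shape in which integrability of all of them is available,
  with \<open>e\<close> the map that takes a point to its tetrahedron.
\<close>

lemma bdf2_integral_identity:
  fixes A B C :: "'c \<Rightarrow> 'v::real_inner"
  assumes "\<And>\<Phi> :: 'c \<Rightarrow> real. set_integrable M S (\<lambda>x. \<Phi> (e x))"
  defines "I \<equiv> \<lambda>\<Phi>. LINT x:S|M. \<Phi> (e x) \<bullet> \<Phi> (e x)"
  shows "2 * (LINT x:S|M. A (e x) \<bullet> (3 *\<^sub>R A (e x) - 4 *\<^sub>R B (e x) + C (e x))) =
    I A + I (\<lambda>T. 2 *\<^sub>R A T - B T) - I B - I (\<lambda>T. 2 *\<^sub>R B T - C T) + I (\<lambda>T. A T - 2 *\<^sub>R B T + C T)"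
proof -
  have int: "set_integrable M S (\<lambda>x. \<Psi> (e x) \<bullet> \<Phi> (e x))" for \<Psi> \<Phi> :: "'c \<Rightarrow> 'v"
    using assms(1)[of "\<lambda>T. \<Psi> T \<bullet> \<Phi> T"] .
  have "I A + I (\<lambda>T. 2 *\<^sub>R A T - B T) - I B - I (\<lambda>T. 2 *\<^sub>R B T - C T) + I (\<lambda>T. A T - 2 *\<^sub>R B T + C T) =
    (LINT x:S|M. A (e x) \<bullet> A (e x) + (2 *\<^sub>R A (e x) - B (e x)) \<bullet> (2 *\<^sub>R A (e x) - B (e x))
      - B (e x) \<bullet> B (e x) - (2 *\<^sub>R B (e x) - C (e x)) \<bullet> (2 *\<^sub>R B (e x) - C (e x))
      + (A (e x) - 2 *\<^sub>R B (e x) + C (e x)) \<bullet> (A (e x) - 2 *\<^sub>R B (e x) + C (e x)))"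
    unfolding I_def
    using int[of A A] int[of B B] int[of "\<lambda>T. 2 *\<^sub>R A T - B T" "\<lambda>T. 2 *\<^sub>R A T - B T"]
      int[of "\<lambda>T. 2 *\<^sub>R B T - C T" "\<lambda>T. 2 *\<^sub>R B T - C T"]
      int[of "\<lambda>T. A T - 2 *\<^sub>R B T + C T" "\<lambda>T. A T - 2 *\<^sub>R B T + C T"]
    by (simp only: set_integral_add set_integral_diff)
  also have "\<dots> = (LINT x:S|M. 2 * (A (e x) \<bullet> (3 *\<^sub>R A (e x) - 4 *\<^sub>R B (e x) + C (e x))))"
  proof (rule arg_cong[where f = "set_lebesgue_integral M S"], rule ext)
    fix x
    show "A (e x) \<bullet> A (e x) + (2 *\<^sub>R A (e x) - B (e x)) \<bullet> (2 *\<^sub>R A (e x) - B (e x))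
      - B (e x) \<bullet> B (e x) - (2 *\<^sub>R B (e x) - C (e x)) \<bullet> (2 *\<^sub>R B (e x) - C (e x))
      + (A (e x) - 2 *\<^sub>R B (e x) + C (e x)) \<bullet> (A (e x) - 2 *\<^sub>R B (e x) + C (e x)) =
      2 * (A (e x) \<bullet> (3 *\<^sub>R A (e x) - 4 *\<^sub>R B (e x) + C (e x)))"
      by (simp add: inner_add_left inner_add_right inner_diff_left inner_diff_right
          inner_commute[of "B (e x)" "A (e x)"] inner_commute[of "C (e x)" "A (e x)"]
          inner_commute[of "C (e x)" "B (e x)"])
  qed
  also have "\<dots> = 2 * (LINT x:S|M. A (e x) \<bullet> (3 *\<^sub>R A (e x) - 4 *\<^sub>R B (e x) + C (e x)))"
    by (rule set_integral_mult_right)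
  finally show ?thesis by simp
qed

lemma set_integral_nonneg:
  assumes "\<And>x. x \<in> S \<Longrightarrow> 0 \<le> (f x :: real)"
  shows "0 \<le> (LINT x:S|M. f x)"
  unfolding set_lebesgue_integral_def using assms
  by (intro Bochner_Integration.integral_nonneg) (auto simp: indicator_def)

lemma surf_norm_power2: "(surf_norm K \<phi>h u)\<^sup>2 = surf_ip K \<phi>h u u"
  unfolding surf_norm_def surf_ip_def by (simp add: set_integral_nonneg)

lemma bulk_norm_power2: "(bulk_norm K u)\<^sup>2 = bulk_ip K u u"
  unfolding bulk_norm_def bulk_ip_def by (simp add: set_integral_nonneg)

section \<open>Telescoping identities on the cut mesh\<close>

text \<open>
  What is used of the cut mesh.  Nonempty interiors make elementwise gradients unique, hence
  linear; compactness and the nonvanishing gradient of the level set function give the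
  discrete surface finite area.
\<close>

locale cut_tetrahedra =
  fixes K :: "(real^3) set set" and \<phi>h :: "real^3 \<Rightarrow> real"
  assumes finite_K: "finite K"
    and compact_cell: "T \<in> K \<Longrightarrow> compact T"
    and interior_cell: "T \<in> K \<Longrightarrow> interior T \<noteq> {}"
    and P1_level_set: "T \<in> K \<Longrightarrow> P1_on T \<phi>h"
    and level_set_grad_nonzero: "T \<in> K \<Longrightarrow> elem_grad T \<phi>h \<noteq> 0"
begin

lemma fe_grad_lincomb3:
  assumes "u \<in> fe_space K" "v \<in> fe_space K" "w \<in> fe_space K" "x \<in> \<Union>K"
  shows "fe_grad K (\<lambda>x. \<alpha> * u x + \<beta> * v x + \<gamma> * w x) x =
    \<alpha> *\<^sub>R fe_grad K u x + \<beta> *\<^sub>R fe_grad K v x + \<gamma> *\<^sub>R fe_grad K w x"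
proof -
  have int: "\<forall>T\<in>K. interior T \<noteq> {}" using interior_cell by blast
  show ?thesis
    using fe_grad_lincomb[OF int fe_space_lincomb[OF assms(1,2), of \<alpha> \<beta>] assms(3,4), of 1 \<gamma>]
      fe_grad_lincomb[OF int assms(1,2,4), of \<alpha> \<beta>]
    by simp
qed

lemma surf_grad_lincomb3:
  assumes "u \<in> fe_space K" "v \<in> fe_space K" "w \<in> fe_space K" "x \<in> \<Union>K"
  shows "surf_grad K \<phi>h (\<lambda>x. \<alpha> * u x + \<beta> * v x + \<gamma> * w x) x =
    \<alpha> *\<^sub>R surf_grad K \<phi>h u x + \<beta> *\<^sub>R surf_grad K \<phi>h v x + \<gamma> *\<^sub>R surf_grad K \<phi>h w x"
  unfolding surf_grad_def fe_grad_lincomb3[OF assms]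
  by (simp add: matrix_vector_right_distrib matrix_vector_mult_scaleR)

lemma normal_deriv_lincomb3:
  assumes "u \<in> fe_space K" "v \<in> fe_space K" "w \<in> fe_space K" "x \<in> \<Union>K"
  shows "normal_deriv K \<phi>h (\<lambda>x. \<alpha> * u x + \<beta> * v x + \<gamma> * w x) x =
    \<alpha> * normal_deriv K \<phi>h u x + \<beta> * normal_deriv K \<phi>h v x + \<gamma> * normal_deriv K \<phi>h w x"
  unfolding normal_deriv_def fe_grad_lincomb3[OF assms]
  by (simp add: inner_add_right)

lemma set_integrable_surface:
  "set_integrable surface_measure (discrete_surface K \<phi>h) (\<lambda>x. \<Phi> (elem_at K x) :: real)"
proof -
  have sets: "sets surface_measure = sets borel"
    unfolding surface_measure_def by (simp add: sets_measure_of sets.sigma_sets_eq[of borel, simplified])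
  have "closed (discrete_surface K \<phi>h)" "hausdorff2 (discrete_surface K \<phi>h) < \<infinity>"
    using discrete_surface_closed_finite[OF finite_K compact_cell interior_cell P1_level_set level_set_grad_nonzero]
    by auto
  then show ?thesis
    using finite_K compact_cell compact_imp_closed
    by (intro set_integrable_elementwise sets)
      (auto simp: emeasure_surface_measure borel_closed discrete_surface_def)
qed

lemma set_integrable_bulk: "set_integrable lborel (\<Union>K) (\<lambda>x. \<Phi> (elem_at K x) :: real)"
proof -
  have "compact (\<Union>K)" using finite_K compact_cell by (intro compact_Union) auto
  then show ?thesis
    using finite_K compact_cell compact_imp_closed
    by (intro set_integrable_elementwise) (auto simp: borel_compact emeasure_compact_finite[unfolded infinity_ennreal_def])
qed

text \<open>
  The next two lemmas are the telescoping identity for the tangential and the normal part of the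
  bilinear form that the chemical potential equation contains.
\<close>

lemma surf_ip_bdf2:
  assumes abc: "a \<in> fe_space K" "b \<in> fe_space K" "c \<in> fe_space K"
  shows "2 * surf_ip K \<phi>h (surf_grad K \<phi>h a) (surf_grad K \<phi>h (\<lambda>x. 3 * a x - 4 * b x + c x)) =
    (surf_norm K \<phi>h (surf_grad K \<phi>h a))\<^sup>2
    + (surf_norm K \<phi>h (\<lambda>x. 2 *\<^sub>R surf_grad K \<phi>h a x - surf_grad K \<phi>h b x))\<^sup>2
    - (surf_norm K \<phi>h (surf_grad K \<phi>h b))\<^sup>2
    - (surf_norm K \<phi>h (\<lambda>x. 2 *\<^sub>R surf_grad K \<phi>h b x - surf_grad K \<phi>h c x))\<^sup>2
    + (surf_norm K \<phi>h (\<lambda>x. surf_grad K \<phi>h a x - 2 *\<^sub>R surf_grad K \<phi>h b x + surf_grad K \<phi>h c x))\<^sup>2"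
proof -
  \<comment> \<open>The surface gradient depends on the point only through the selected tetrahedron, since the
    discrete normal does.\<close>
  define G where "G = (\<lambda>v T. (mat 1 - (\<chi> i j. (elem_grad T \<phi>h /\<^sub>R norm (elem_grad T \<phi>h)) $ i *
    (elem_grad T \<phi>h /\<^sub>R norm (elem_grad T \<phi>h)) $ j)) *v elem_grad T v)"
  have G: "surf_grad K \<phi>h v x = G v (elem_at K x)" for v x
    unfolding surf_grad_def tangent_proj_def discrete_normal_def fe_grad_def G_def ..
  have "surf_grad K \<phi>h (\<lambda>x. 3 * a x - 4 * b x + c x) x =
      3 *\<^sub>R G a (elem_at K x) - 4 *\<^sub>R G b (elem_at K x) + G c (elem_at K x)"
    if "x \<in> discrete_surface K \<phi>h" for x
    using surf_grad_lincomb3[OF abc, of x 3 "-4" 1] that by (simp add: discrete_surface_def G)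
  then have "surf_ip K \<phi>h (surf_grad K \<phi>h a) (surf_grad K \<phi>h (\<lambda>x. 3 * a x - 4 * b x + c x)) =
    (LINT x:discrete_surface K \<phi>h|surface_measure.
      G a (elem_at K x) \<bullet> (3 *\<^sub>R G a (elem_at K x) - 4 *\<^sub>R G b (elem_at K x) + G c (elem_at K x)))"
    unfolding surf_ip_def set_lebesgue_integral_def
    by (intro Bochner_Integration.integral_cong) (auto simp: indicator_def G)
  then show ?thesis
    unfolding surf_norm_power2 surf_ip_def G
    using bdf2_integral_identity[OF set_integrable_surface, where A = "G a" and B = "G b" and C = "G c"] by simp
qed

lemma bulk_ip_bdf2:
  assumes abc: "a \<in> fe_space K" "b \<in> fe_space K" "c \<in> fe_space K"
  shows "2 * bulk_ip K (normal_deriv K \<phi>h a) (normal_deriv K \<phi>h (\<lambda>x. 3 * a x - 4 * b x + c x)) =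
    (bulk_norm K (normal_deriv K \<phi>h a))\<^sup>2
    + (bulk_norm K (normal_deriv K \<phi>h (\<lambda>x. 2 * a x - b x)))\<^sup>2
    - (bulk_norm K (normal_deriv K \<phi>h b))\<^sup>2
    - (bulk_norm K (normal_deriv K \<phi>h (\<lambda>x. 2 * b x - c x)))\<^sup>2
    + (bulk_norm K (normal_deriv K \<phi>h (\<lambda>x. a x - 2 * b x + c x)))\<^sup>2"
proof -
  define D where "D = (\<lambda>v T. (elem_grad T \<phi>h /\<^sub>R norm (elem_grad T \<phi>h)) \<bullet> elem_grad T v)"
  have D: "normal_deriv K \<phi>h v x = D v (elem_at K x)" for v x
    unfolding normal_deriv_def discrete_normal_def fe_grad_def D_def ..
  \<comment> \<open>Unlike the surface terms, the bulk terms apply the normal derivative to combinations of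
    iterates; off \<open>\<Union>K\<close> these need not be combinations of derivatives, so
    representation by a function of the tetrahedron is only asked on \<open>\<Union>K\<close>.\<close>
  define rep where "rep = (\<lambda>u (U :: (real^3) set \<Rightarrow> real). \<forall>x\<in>\<Union>K. u x = U (elem_at K x))"
  have ip: "bulk_ip K u w = (LINT x:\<Union>K|lborel. U (elem_at K x) \<bullet> W (elem_at K x))"
    if "rep u U" "rep w W" for u w U W
    unfolding bulk_ip_def set_lebesgue_integral_def
  proof (rule Bochner_Integration.integral_cong[OF refl])
    fix x
    show "indicator (\<Union>K) x *\<^sub>R (u x * w x) =
        indicator (\<Union>K) x *\<^sub>R (U (elem_at K x) \<bullet> W (elem_at K x))"
      using that unfolding rep_def by (cases "x \<in> \<Union>K") auto
  qed
  have rep: "rep (normal_deriv K \<phi>h v) (D v)" for v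
    by (simp add: rep_def D)
  have rep_diff: "rep (normal_deriv K \<phi>h (\<lambda>x. 2 * u x - v x)) (\<lambda>T. 2 *\<^sub>R D u T - D v T)"
    if uv: "u \<in> fe_space K" "v \<in> fe_space K" for u v
    unfolding rep_def
  proof
    fix x assume "x \<in> \<Union>K"
    from normal_deriv_lincomb3[OF uv uv(2) this, of 2 "-1" 0]
    show "normal_deriv K \<phi>h (\<lambda>x. 2 * u x - v x) x = 2 *\<^sub>R D u (elem_at K x) - D v (elem_at K x)"
      unfolding D by simp
  qed
  have rep_bdf2: "rep (normal_deriv K \<phi>h (\<lambda>x. 3 * a x - 4 * b x + c x))
      (\<lambda>T. 3 *\<^sub>R D a T - 4 *\<^sub>R D b T + D c T)"
    unfolding rep_def
  proof
    fix x assume "x \<in> \<Union>K"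
    from normal_deriv_lincomb3[OF abc this, of 3 "-4" 1]
    show "normal_deriv K \<phi>h (\<lambda>x. 3 * a x - 4 * b x + c x) x =
        3 *\<^sub>R D a (elem_at K x) - 4 *\<^sub>R D b (elem_at K x) + D c (elem_at K x)"
      unfolding D by simp
  qed
  have rep_diff2: "rep (normal_deriv K \<phi>h (\<lambda>x. a x - 2 * b x + c x))
      (\<lambda>T. D a T - 2 *\<^sub>R D b T + D c T)"
    unfolding rep_def
  proof
    fix x assume "x \<in> \<Union>K"
    from normal_deriv_lincomb3[OF abc this, of 1 "-2" 1]
    show "normal_deriv K \<phi>h (\<lambda>x. a x - 2 * b x + c x) x =
        D a (elem_at K x) - 2 *\<^sub>R D b (elem_at K x) + D c (elem_at K x)"
      unfolding D by simp
  qed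
  show ?thesis
    unfolding bulk_norm_power2 ip[OF rep rep_bdf2] ip[OF rep_diff2 rep_diff2]
      ip[OF rep_diff[OF abc(1,2)] rep_diff[OF abc(1,2)]] ip[OF rep_diff[OF abc(2,3)] rep_diff[OF abc(2,3)]]
      ip[OF rep[of a] rep[of a]] ip[OF rep[of b] rep[of b]]
    by (rule bdf2_integral_identity[OF set_integrable_bulk])
qed

end

lemma shape_regular_interior:
  assumes "shape_regular \<sigma> T"
  shows "interior T \<noteq> {}"
proof -
  obtain x r where "0 < r" "ball x r \<subseteq> T" using assms unfolding shape_regular_def by blast
  then have "x \<in> interior T" by (auto simp: mem_interior)
  then show ?thesis by blast
qed

lemma cut_tetrahedra_cut_mesh:
  assumes "tetrahedral_mesh \<Omega> \<T> \<sigma> h" and "P1_interpolant \<T> \<phi> \<phi>h"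
    and "\<forall>T\<in>cut_mesh \<T> \<Gamma>. elem_grad T \<phi>h \<noteq> 0"
  shows "cut_tetrahedra (cut_mesh \<T> \<Gamma>) \<phi>h"
proof
  show "finite (cut_mesh \<T> \<Gamma>)"
    using assms(1) by (simp add: cut_mesh_def tetrahedral_mesh_def triangulation_def)
  fix T assume T: "T \<in> cut_mesh \<T> \<Gamma>"
  then have "T \<in> \<T>" by (simp add: cut_mesh_def)
  then have "3 simplex T" "shape_regular \<sigma> T" "P1_on T \<phi>h"
    using assms by (auto simp: tetrahedral_mesh_def P1_interpolant_def)
  then show "compact T" "interior T \<noteq> {}" "P1_on T \<phi>h"
    by (auto simp: compact_simplex shape_regular_interior)
  show "elem_grad T \<phi>h \<noteq> 0" using assms(3) T by blast
qed

section \<open>Energy balance\<close>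

text \<open>
  The first equation is tested with \<open>\<mu>\<^sup>n\<^sup>+\<^sup>1\<close> and the second with
  \<open>3 c\<^sup>n\<^sup>+\<^sup>1 - 4 c\<^sup>n + c\<^sup>n\<^sup>-\<^sup>1\<close>.
  Both then contain the same product of these two functions, and eliminating it equates the
  dissipation with three terms, each of which telescopes.  In the nonlinear term the update of
  \<open>r\<close> replaces the integral of \<open>f0'\<close> as a whole by a difference of \<open>r\<close>
  values; this is the purpose of the auxiliary variable.
\<close>

lemma (in cut_tetrahedra) sav_bdf2_step_energy_balance:
  assumes step: "sav_bdf2_step \<Gamma> K \<phi>h h \<rho> \<epsilon> \<Delta>t c \<mu> r n"
    and c: "\<And>m. c m \<in> fe_space K" and \<mu>: "\<mu> (n+1) \<in> fe_space K"
    and E1: "0 < E1 \<Gamma> (extrap c n)" and \<rho>: "0 < \<rho>" and \<Delta>t: "0 < \<Delta>t"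
  shows "mod_energy K \<phi>h h \<epsilon> c r (n+1) - mod_energy K \<phi>h h \<epsilon> c r n
      + \<epsilon>\<^sup>2 / 2 * (surf_norm K \<phi>h (\<lambda>x. surf_grad K \<phi>h (c (n+1)) x
            - 2 *\<^sub>R surf_grad K \<phi>h (c n) x + surf_grad K \<phi>h (c (n-1)) x))\<^sup>2
      + \<bar>r (n+1) - 2 * r n + r (n-1)\<bar>\<^sup>2
      + inverse h * \<epsilon>\<^sup>2 / 2 *
          (bulk_norm K (normal_deriv K \<phi>h (\<lambda>x. c (n+1) x - 2 * c n x + c (n-1) x)))\<^sup>2
      = - (2 * \<Delta>t / \<rho>) * surf_ip K \<phi>h
            (\<lambda>x. mobility (extrap c n x) *\<^sub>R surf_grad K \<phi>h (\<mu> (n+1)) x) (surf_grad K \<phi>h (\<mu> (n+1)))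
        - 2 * h * \<Delta>t / \<rho> * (bulk_norm K (normal_deriv K \<phi>h (\<mu> (n+1))))\<^sup>2"
    (is "_ = - (2 * \<Delta>t / \<rho>) * ?M - 2 * h * \<Delta>t / \<rho> * ?N")
proof -
  define \<delta> where "\<delta> = (\<lambda>x. 3 * c (n+1) x - 4 * c n x + c (n-1) x)"
  define s where "s = sqrt (E1 \<Gamma> (extrap c n))"
  define P where "P = surf_ip K \<phi>h (\<lambda>x. deriv f0 (extrap c n x)) \<delta>"
  define X where "X = surf_ip K \<phi>h (surf_grad K \<phi>h (c (n+1))) (surf_grad K \<phi>h \<delta>)"
  define Y where "Y = bulk_ip K (normal_deriv K \<phi>h (c (n+1))) (normal_deriv K \<phi>h \<delta>)"
  have \<delta>: "\<delta> \<in> fe_space K"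
    using fe_space_lincomb[OF fe_space_lincomb[OF c c, of 3 "n+1" "-4" n] c[of "n-1"], of 1 1]
    by (simp add: \<delta>_def)
  have s: "0 < s" using E1 by (simp add: s_def)
  have eq1: "\<rho> / (2 * \<Delta>t) * surf_ip K \<phi>h \<delta> (\<mu> (n+1)) = - ?M - h * ?N"
    and eq2: "surf_ip K \<phi>h (\<mu> (n+1)) \<delta> = r (n+1) / s * P + \<epsilon>\<^sup>2 * X + inverse h * \<epsilon>\<^sup>2 * Y"
    and eq3: "3 * r (n+1) - 4 * r n + r (n-1) = 1 / (2 * s) * P"
    using step \<delta> \<mu> unfolding sav_bdf2_step_def P_def X_def Y_def s_def \<delta>_def bulk_norm_power2
    by blast+
  have "surf_ip K \<phi>h \<delta> (\<mu> (n+1)) = 2 * \<Delta>t / \<rho> * (\<rho> / (2 * \<Delta>t) * surf_ip K \<phi>h \<delta> (\<mu> (n+1)))"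
    using \<rho> \<Delta>t by simp
  also have "\<dots> = - (2 * \<Delta>t / \<rho>) * ?M - 2 * h * \<Delta>t / \<rho> * ?N"
    unfolding eq1 by (simp add: algebra_simps)
  finally have rhs: "surf_ip K \<phi>h \<delta> (\<mu> (n+1)) = - (2 * \<Delta>t / \<rho>) * ?M - 2 * h * \<Delta>t / \<rho> * ?N" .
  have sym: "surf_ip K \<phi>h (\<mu> (n+1)) \<delta> = surf_ip K \<phi>h \<delta> (\<mu> (n+1))"
    unfolding surf_ip_def by (simp add: mult.commute)
  \<comment> \<open>The factor 2 comes from \<open>1 / (2 * s)\<close> in the update of \<open>r\<close>, so that the
    scalar telescoping identity applies without a factor one half.\<close>
  have "r (n+1) / s * P = 2 * r (n+1) * (3 * r (n+1) - 4 * r n + r (n-1))"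
    unfolding eq3 using s by simp
  also have "\<dots> = (r (n+1))\<^sup>2 + (2 * r (n+1) - r n)\<^sup>2 - (r n)\<^sup>2 - (2 * r n - r (n-1))\<^sup>2
      + (r (n+1) - 2 * r n + r (n-1))\<^sup>2"
    by (simp add: power2_eq_square algebra_simps)
  finally have R: "r (n+1) / s * P = (r (n+1))\<^sup>2 + (2 * r (n+1) - r n)\<^sup>2 - (r n)\<^sup>2
      - (2 * r n - r (n-1))\<^sup>2 + (r (n+1) - 2 * r n + r (n-1))\<^sup>2" .
  have X: "\<epsilon>\<^sup>2 * X = \<epsilon>\<^sup>2 / 2 * (2 * X)" and Y: "inverse h * \<epsilon>\<^sup>2 * Y = inverse h * \<epsilon>\<^sup>2 / 2 * (2 * Y)"
    by auto
  have "r (n+1) / s * P + \<epsilon>\<^sup>2 / 2 * (2 * X) + inverse h * \<epsilon>\<^sup>2 / 2 * (2 * Y) =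
      - (2 * \<Delta>t / \<rho>) * ?M - 2 * h * \<Delta>t / \<rho> * ?N"
    using eq2 sym rhs by simp
  then show ?thesis
    unfolding R X_def Y_def \<delta>_def surf_ip_bdf2[OF c c c] bulk_ip_bdf2[OF c c c]
      mod_energy_def power2_abs add_diff_cancel_right'
    by (simp only: distrib_left right_diff_distrib)
qed

theorem theorem3p2:
  fixes \<Omega> \<Gamma> :: "(real^3) set" and \<phi> \<phi>h c_init :: "real^3 \<Rightarrow> real"
    and \<T> K :: "(real^3) set set"
    and \<sigma> h \<rho> \<epsilon> \<Delta>t :: real
    and c \<mu> :: "nat \<Rightarrow> real^3 \<Rightarrow> real" and r :: "nat \<Rightarrow> real"
  assumes "level_set_surface \<Omega> \<phi> \<Gamma>"
    and "tetrahedral_mesh \<Omega> \<T> \<sigma> h"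
    and "P1_interpolant \<T> \<phi> \<phi>h"
    and "K = cut_mesh \<T> \<Gamma>"
    and "\<forall>T\<in>K. elem_grad T \<phi>h \<noteq> 0"
    and "0 < \<rho>" and "0 < \<epsilon>" and "0 < \<Delta>t"
    and "sav_bdf2_scheme \<Gamma> K \<phi>h h \<rho> \<epsilon> \<Delta>t c_init c \<mu> r"
  shows "\<forall>n\<ge>1.
      ((mod_energy K \<phi>h h \<epsilon> c r (n+1) - mod_energy K \<phi>h h \<epsilon> c r n)
      + \<epsilon>\<^sup>2 / 2 * (surf_norm K \<phi>h (\<lambda>x. surf_grad K \<phi>h (c (n+1)) x
            - 2 *\<^sub>R surf_grad K \<phi>h (c n) x + surf_grad K \<phi>h (c (n-1)) x))\<^sup>2
      + \<bar>r (n+1) - 2 * r n + r (n-1)\<bar>\<^sup>2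
      + inverse h * \<epsilon>\<^sup>2 / 2 *
          (bulk_norm K (normal_deriv K \<phi>h (\<lambda>x. c (n+1) x - 2 * c n x + c (n-1) x)))\<^sup>2
      = - (2 * \<Delta>t / \<rho>) * surf_ip K \<phi>h
            (\<lambda>x. mobility (extrap c n x) *\<^sub>R surf_grad K \<phi>h (\<mu> (n+1)) x) (surf_grad K \<phi>h (\<mu> (n+1)))
        - 2 * h * \<Delta>t / \<rho> * (bulk_norm K (normal_deriv K \<phi>h (\<mu> (n+1))))\<^sup>2)
      \<and> ((\<forall>x \<in> discrete_surface K \<phi>h. 0 \<le> mobility (extrap c n x)) \<longrightarrow>
          mod_energy K \<phi>h h \<epsilon> c r (n+1) \<le> mod_energy K \<phi>h h \<epsilon> c r n)"
proof (intro allI impI)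
  fix n :: nat assume n: "1 \<le> n"
  interpret cut_tetrahedra K \<phi>h
    using cut_tetrahedra_cut_mesh assms(2-5) by blast
  let ?M = "surf_ip K \<phi>h (\<lambda>x. mobility (extrap c n x) *\<^sub>R surf_grad K \<phi>h (\<mu> (n+1)) x)
    (surf_grad K \<phi>h (\<mu> (n+1)))"
  have balance: "mod_energy K \<phi>h h \<epsilon> c r (n+1) - mod_energy K \<phi>h h \<epsilon> c r n
      + \<epsilon>\<^sup>2 / 2 * (surf_norm K \<phi>h (\<lambda>x. surf_grad K \<phi>h (c (n+1)) x
            - 2 *\<^sub>R surf_grad K \<phi>h (c n) x + surf_grad K \<phi>h (c (n-1)) x))\<^sup>2
      + \<bar>r (n+1) - 2 * r n + r (n-1)\<bar>\<^sup>2
      + inverse h * \<epsilon>\<^sup>2 / 2 *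
          (bulk_norm K (normal_deriv K \<phi>h (\<lambda>x. c (n+1) x - 2 * c n x + c (n-1) x)))\<^sup>2
      = - (2 * \<Delta>t / \<rho>) * ?M - 2 * h * \<Delta>t / \<rho> * (bulk_norm K (normal_deriv K \<phi>h (\<mu> (n+1))))\<^sup>2"
    (is "?d + ?a1 + ?a2 + ?a3 = - (2 * \<Delta>t / \<rho>) * ?M - ?b")
    using assms(6,8,9) n unfolding sav_bdf2_scheme_def
    by (intro sav_bdf2_step_energy_balance) auto
  have "mod_energy K \<phi>h h \<epsilon> c r (n+1) \<le> mod_energy K \<phi>h h \<epsilon> c r n"
    if "\<forall>x \<in> discrete_surface K \<phi>h. 0 \<le> mobility (extrap c n x)"
  proof -
    have h: "0 < h" using assms(2) by (simp add: tetrahedral_mesh_def)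
    have "0 \<le> ?M"
      unfolding surf_ip_def using that by (intro set_integral_nonneg) auto
    then have "0 \<le> 2 * \<Delta>t / \<rho> * ?M" using assms(6,8) by (intro mult_nonneg_nonneg) auto
    moreover have "0 \<le> ?a1" "0 \<le> ?a2" "0 \<le> ?a3" "0 \<le> ?b" using h assms(6,8) by auto
    ultimately show ?thesis using balance by linarith
  qed
  with balance show "(?d + ?a1 + ?a2 + ?a3 = - (2 * \<Delta>t / \<rho>) * ?M - ?b) \<and>
      ((\<forall>x \<in> discrete_surface K \<phi>h. 0 \<le> mobility (extrap c n x)) \<longrightarrow>
        mod_energy K \<phi>h h \<epsilon> c r (n+1) \<le> mod_energy K \<phi>h h \<epsilon> c r n)"
    by blast
qed

end
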